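(* For each $p\in(1,\infty)$ and $d\ge1$, $$\|\mathcal{G}^{d+1}_\ast\|_{L^p(\mathbb{R}^{d+1})}\ge\|\mathcal{G}^{d}_\ast\|_{L^p(\mathbb{R}^{d})}.$$ Moreover, there exists a constant $c$ with $0.4<c\le1$ such that for every $p\in(1,\infty)$ $$\|\mathcal{G}^1_\ast\|_{L^p(\mathbb{R})}\ge\max\Big\{c\,\frac{p}{p-1},\,1\Big\}.$$ In particular, $\|\mathcal{G}^1_\ast\|_{L^p(\mathbb{R})}>\frac25\frac{p}{p-1}>1$ for all $p\in(1,\frac53)$.
   Context: For $t>0$ and $d\ge1$, $\mathcal{G}^d_tf(x)=(2\pi t^2)^{-d/2}\int_{\mathbb{R}^d}e^{-|y|^2/(2t^2)}f(x-y)\,dy$, $x\in\mathbb{R}^d$, and $\mathcal{G}^d_\ast f(x)=\sup_{t>0}|\mathcal{G}^d_tf(x)|$. $\|\mathcal{G}^d_\ast\|_{L^p(\mathbb{R}^d)}$ is the best constant $C$ in $\|\mathcal{G}^d_\ast f\|_{L^p(\mathbb{R}^d)}\le C\|f\|_{L^p(\mathbb{R}^d)}$, $f\in L^p(\mathbb{R}^d)$. *)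

theory Defs
  imports "HOL-Analysis.Analysis"
begin

text \<open>
  The space $R^d$ is represented by a type of class \<^class>\<open>euclidean_space\<close> of dimension $d$
  (so $d \ge 1$ holds automatically), carrying its Euclidean norm and Lebesgue measure.
  Functions are real-valued.
\<close>

text \<open>Powers with a positive real exponent on $[0,\infty]$; meant for \<open>p > 0\<close> only.\<close>

definition ennreal_powr :: "ennreal \<Rightarrow> real \<Rightarrow> ennreal"
  where "ennreal_powr x p = (if x = \<infinity> then \<infinity> else ennreal (enn2real x powr p))"

text \<open>
  The $L^p$ norm with values in $[0,\infty]$.  Its argument is the absolute value of the function,
  because a maximal function may take the value $\infty$.
\<close>

definition Lp_norm :: "real \<Rightarrow> ('a::euclidean_space \<Rightarrow> ennreal) \<Rightarrow> ennreal"
  where "Lp_norm p g = ennreal_powr (\<integral>\<^sup>+ x. ennreal_powr (g x) p \<partial>lebesgue) (1 / p)"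

definition Lp_space :: "real \<Rightarrow> ('a::euclidean_space \<Rightarrow> real) set"
  where "Lp_space p = {f \<in> borel_measurable lebesgue. Lp_norm p (\<lambda>x. ennreal \<bar>f x\<bar>) < \<infinity>}"

definition gauss_op :: "real \<Rightarrow> ('a::euclidean_space \<Rightarrow> real) \<Rightarrow> 'a \<Rightarrow> real"
  where "gauss_op t f x =
    (2 * pi * t\<^sup>2) powr (- real DIM('a) / 2) *
    (LINT y|lebesgue. exp (- (norm y)\<^sup>2 / (2 * t\<^sup>2)) * f (x - y))"

definition gauss_max :: "('a::euclidean_space \<Rightarrow> real) \<Rightarrow> 'a \<Rightarrow> ennreal"
  where "gauss_max f x = (SUP t\<in>{0<..}. ennreal \<bar>gauss_op t f x\<bar>)"

text \<open>
  The best constant in the maximal inequality on the space \<open>'a\<close>; it is $\infty$ if no finite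
  constant is admissible.
\<close>

definition gauss_max_norm :: "'a::euclidean_space itself \<Rightarrow> real \<Rightarrow> ennreal"
  where "gauss_max_norm _ p =
    Inf {C. \<forall>f \<in> (Lp_space p :: ('a \<Rightarrow> real) set).
              Lp_norm p (gauss_max f) \<le> C * Lp_norm p (\<lambda>x. ennreal \<bar>f x\<bar>)}"

end

theory Submission
  imports Defs "HOL-Probability.Distributions" "HOL-Real_Asymp.Real_Asymp"
begin

text \<open>
  A lower bound for the best constant comes from testing with nonnegative Borel functions, for which
  the Gaussian averages are Tonelli integrals and the maximal function is lower semicontinuous.

  For the comparison of dimensions, \<open>f\<close> on \<open>R\<^sup>d\<close> is tested as \<open>F (x, u) = f x\<close> on the slab \<open>\<bar>u\<bar> < N\<close>.
  Away from the faces of the slab the extra factor is almost 1, and after rescaling \<open>u\<close> by \<open>N\<close>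
  Fatou's lemma recovers the inequality for \<open>f\<close> as \<open>N\<close> tends to infinity.

  In dimension one, the function \<open>\<bar>x\<bar>\<^sup>-\<^sup>s\<close> on \<open>[-1, 1]\<close> with \<open>s < 1 / p\<close> lies in \<open>L\<^sup>p\<close>, and
  by homogeneity its average at time \<open>\<bar>x\<bar>\<close> is at least \<open>A\<^sub>s \<bar>x\<bar>\<^sup>-\<^sup>s\<close> with \<open>A\<^sub>s\<close> of order
  \<open>1 / (1 - s)\<close>. So every admissible constant is at least \<open>A\<^sub>s\<close>, and \<open>s\<close> tends to \<open>1 / p\<close>.
  The bound 1 comes from an interval and small times.
\<close>

section \<open>Real powers on the extended half-line\<close>

lemma ennreal_powr_ennreal: "0 \<le> x \<Longrightarrow> ennreal_powr (ennreal x) p = ennreal (x powr p)"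
  by (simp add: ennreal_powr_def)

lemma ennreal_powr_mono: "0 \<le> p \<Longrightarrow> x \<le> y \<Longrightarrow> ennreal_powr x p \<le> ennreal_powr y p"
  by (cases x; cases y) (auto simp: ennreal_powr_def intro!: ennreal_leI powr_mono2 simp: top_unique)

lemma ennreal_powr_inverse: "0 < p \<Longrightarrow> ennreal_powr (ennreal_powr x p) (1 / p) = x"
  by (cases x) (auto simp: ennreal_powr_def powr_powr)

lemma ennreal_powr_inverse': "0 < p \<Longrightarrow> ennreal_powr (ennreal_powr x (1 / p)) p = x"
  by (cases x) (auto simp: ennreal_powr_def powr_powr)

lemma ennreal_powr_le_iff:
  assumes "0 < p" shows "ennreal_powr x p \<le> ennreal_powr y p \<longleftrightarrow> x \<le> y"
  using ennreal_powr_mono[of p x y] ennreal_powr_mono[of "1 / p" "ennreal_powr x p" "ennreal_powr y p"] assms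
  by (auto simp: ennreal_powr_inverse)

lemma ennreal_powr_mult:
  assumes "0 < p" shows "ennreal_powr (x * y) p = ennreal_powr x p * ennreal_powr y p"
proof (cases "x = \<infinity> \<or> y = \<infinity>")
  case True
  then show ?thesis
    using assms by (cases "x = 0"; cases "y = 0")
      (auto simp: ennreal_powr_def ennreal_mult_top ennreal_top_mult enn2real_eq_0_iff)
next
  case False
  then show ?thesis
    by (cases x; cases y) (auto simp: ennreal_powr_def powr_mult enn2real_mult simp flip: ennreal_mult)
qed

lemma ennreal_powr_measurable [measurable]: "(\<lambda>x. ennreal_powr x p) \<in> borel_measurable borel"
  unfolding ennreal_powr_def by measurable

text \<open>Near the limit 1 the values are eventually finite, so continuity of the real power
  suffices. It is applied to the factor by which a slab of finite width reduces an average.\<close>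

lemma tendsto_ennreal_powr_1:
  assumes "(w \<longlongrightarrow> 1) F" shows "((\<lambda>n. ennreal_powr (w n) p) \<longlongrightarrow> 1) F"
proof -
  have "((\<lambda>n. enn2real (w n)) \<longlongrightarrow> 1) F"
    using tendsto_enn2real[of w 1 F] assms by simp
  then have "((\<lambda>n. ennreal (enn2real (w n) powr p)) \<longlongrightarrow> ennreal (1 powr p)) F"
    by (intro tendsto_ennrealI tendsto_powr tendsto_const) auto
  moreover have "\<forall>\<^sub>F n in F. w n < top"
    using order_tendstoD(2)[OF assms, of top] by simp
  then have "\<forall>\<^sub>F n in F. ennreal (enn2real (w n) powr p) = ennreal_powr (w n) p"
    by eventually_elim (auto simp: ennreal_powr_def)
  ultimately show ?thesis
    by (simp cong: filterlim_cong add: tendsto_cong)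
qed

section \<open>Gaussian averages as Tonelli integrals\<close>

definition gauss_kernel :: "real \<Rightarrow> 'a::euclidean_space \<Rightarrow> real"
  where "gauss_kernel t z =
    (2 * pi * t\<^sup>2) powr (- real DIM('a) / 2) * exp (- (norm z)\<^sup>2 / (2 * t\<^sup>2))"

text \<open>Values in [0, infinity] remove every question of integrability. Writing the kernel at
  \<open>x - y\<close> puts the dependence on \<open>x\<close> into a continuous factor, while
  \<open>f\<close> stays fixed.\<close>

definition gauss_conv :: "real \<Rightarrow> ('a::euclidean_space \<Rightarrow> ennreal) \<Rightarrow> 'a \<Rightarrow> ennreal"
  where "gauss_conv t f x = (\<integral>\<^sup>+ y. ennreal (gauss_kernel t (x - y)) * f y \<partial>lborel)"

definition gauss_sup :: "('a::euclidean_space \<Rightarrow> ennreal) \<Rightarrow> 'a \<Rightarrow> ennreal"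
  where "gauss_sup f x = (SUP t\<in>{0<..}. gauss_conv t f x)"

lemma gauss_kernel_measurable [measurable]: "gauss_kernel t \<in> borel_measurable borel"
  unfolding gauss_kernel_def by measurable

lemma gauss_kernel_pos: "0 < t \<Longrightarrow> 0 < gauss_kernel t z"
  by (simp add: gauss_kernel_def)

lemma gauss_kernel_nonneg [simp]: "0 \<le> gauss_kernel t z"
  by (simp add: gauss_kernel_def)

lemma gauss_kernel_le: "gauss_kernel t z \<le> gauss_kernel t (0 :: 'a)" for z :: "'a::euclidean_space"
  by (auto simp: gauss_kernel_def intro!: mult_left_le)

lemma continuous_gauss_kernel: "isCont (gauss_kernel t) z"
  unfolding gauss_kernel_def by (cases "t = 0") (auto intro!: continuous_intros)

text \<open>The supremum runs over uncountably many times, so countable suprema of measurable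
  functions do not suffice. Instead each average is lower semicontinuous by Fatou's lemma: its
  sublevel sets are closed, and so is their intersection over all \<open>t\<close>.\<close>

lemma gauss_sup_measurable [measurable]:
  fixes f :: "'a::euclidean_space \<Rightarrow> ennreal"
  assumes [measurable]: "f \<in> borel_measurable borel"
  shows "gauss_sup f \<in> borel_measurable borel"
proof (rule borel_measurableI_greater)
  fix a :: ennreal
  have "closed {x. gauss_conv t f x \<le> a}" if t: "0 < t" for t
    unfolding closed_sequential_limits
  proof safe
    fix s x assume s: "\<forall>n. s n \<in> {x. gauss_conv t f x \<le> a}" "s \<longlonglongrightarrow> x"
    have "gauss_conv t f x = (\<integral>\<^sup>+ y. liminf (\<lambda>n. ennreal (gauss_kernel t (s n - y)) * f y) \<partial>lborel)"
      unfolding gauss_conv_def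
    proof (intro nn_integral_cong)
      fix y
      have "(\<lambda>n. gauss_kernel t (s n - y)) \<longlonglongrightarrow> gauss_kernel t (x - y)"
        by (intro isCont_tendsto_compose[OF continuous_gauss_kernel] tendsto_intros s)
      \<comment> \<open>Since \<open>f y\<close> may be infinite, the limit of the product requires
        that the limit of the kernel be nonzero.\<close>
      then have "(\<lambda>n. ennreal (gauss_kernel t (s n - y)) * f y) \<longlonglongrightarrow> ennreal (gauss_kernel t (x - y)) * f y"
        using gauss_kernel_pos[OF t, of "x - y"]
        by (intro tendsto_mult_ennreal tendsto_ennrealI tendsto_const) auto
      from lim_imp_Liminf[OF _ this]
      show "ennreal (gauss_kernel t (x - y)) * f y = liminf (\<lambda>n. ennreal (gauss_kernel t (s n - y)) * f y)"
        by simp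
    qed
    also have "\<dots> \<le> liminf (\<lambda>n. gauss_conv t f (s n))"
      unfolding gauss_conv_def by (intro nn_integral_liminf) measurable
    also have "\<dots> \<le> liminf (\<lambda>n. a)"
      using s by (intro Liminf_mono) auto
    finally show "gauss_conv t f x \<le> a" by (simp add: Liminf_const)
  qed
  then have "closed (\<Inter>t\<in>{0<..}. {x. gauss_conv t f x \<le> a})"
    by (intro closed_INT) auto
  also have "(\<Inter>t\<in>{0<..}. {x. gauss_conv t f x \<le> a}) = - {x. a < gauss_sup f x}"
    by (auto simp: gauss_sup_def less_SUP_iff dest: leD)
      (auto simp: not_le[symmetric])
  finally have "open {x. a < gauss_sup f x}"
    by (simp add: open_closed)
  then show "{x \<in> space borel. a < gauss_sup f x} \<in> sets borel" by simp
qed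

lemma nn_integral_exp_square_real:
  assumes "0 < t" shows "(\<integral>\<^sup>+ x. ennreal (exp (- x\<^sup>2 / (2 * t\<^sup>2))) \<partial>(lborel :: real measure)) = ennreal (sqrt (2 * pi * t\<^sup>2))"
proof -
  have eq: "exp (- x\<^sup>2 / (2 * t\<^sup>2)) = sqrt (2 * pi * t\<^sup>2) * normal_density 0 t x" for x
    using assms by (simp add: normal_density_def real_sqrt_mult)
  have "(\<integral>\<^sup>+ x. ennreal (normal_density 0 t x) \<partial>lborel) = 1"
    using assms by (subst nn_integral_eq_integral) auto
  then show ?thesis
    unfolding eq by (simp add: ennreal_mult nn_integral_cmult)
qed

text \<open>The Gaussian is a product over the coordinates, so the integral is a power of the
  one-dimensional one, which is known from the normal density.\<close>

lemma nn_integral_gauss_kernel: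
  assumes "0 < t" shows "(\<integral>\<^sup>+ x. ennreal (gauss_kernel t x) \<partial>(lborel :: 'a::euclidean_space measure)) = 1"
proof -
  have eq: "exp (- (norm x)\<^sup>2 / (2 * t\<^sup>2)) = (\<Prod>b\<in>Basis. exp (- (x \<bullet> b)\<^sup>2 / (2 * t\<^sup>2)))" for x :: 'a
  proof -
    have "- (norm x)\<^sup>2 / (2 * t\<^sup>2) = (\<Sum>b\<in>Basis. - (x \<bullet> b)\<^sup>2 / (2 * t\<^sup>2))"
      unfolding power2_norm_eq_inner
      by (subst euclidean_inner) (simp add: power2_eq_square sum_divide_distrib sum_negf)
    then show ?thesis by (simp add: exp_sum)
  qed
  have "(\<integral>\<^sup>+ x. ennreal (exp (- (norm x)\<^sup>2 / (2 * t\<^sup>2))) \<partial>(lborel :: 'a measure))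
      = (\<integral>\<^sup>+ x. (\<Prod>b\<in>Basis. ennreal (exp (- (x \<bullet> b)\<^sup>2 / (2 * t\<^sup>2)))) \<partial>(lborel :: 'a measure))"
    by (intro nn_integral_cong) (simp only: eq, simp add: prod_ennreal)
  also have "\<dots> = (\<Prod>b\<in>(Basis::'a set). ennreal (sqrt (2 * pi * t\<^sup>2)))"
    by (subst nn_integral_lborel_prod)
      (auto simp del: prod_constant simp: nn_integral_exp_square_real[OF assms, simplified])
  also have "\<dots> = ennreal (sqrt (2 * pi * t\<^sup>2) ^ DIM('a))"
    by (simp add: ennreal_power)
  finally have int: "(\<integral>\<^sup>+ x. ennreal (exp (- (norm x)\<^sup>2 / (2 * t\<^sup>2))) \<partial>(lborel :: 'a measure)) = \<dots>" .
  have "sqrt (2 * pi * t\<^sup>2) ^ DIM('a) = (2 * pi * t\<^sup>2) powr (real DIM('a) / 2)"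
    using assms by (simp add: powr_half_sqrt[symmetric] powr_power)
  then have "(2 * pi * t\<^sup>2) powr (- real DIM('a) / 2) * sqrt (2 * pi * t\<^sup>2) ^ DIM('a) = 1"
    using assms by (simp flip: powr_add)
  moreover have "(\<integral>\<^sup>+ x. ennreal (gauss_kernel t x) \<partial>(lborel :: 'a measure))
      = ennreal ((2 * pi * t\<^sup>2) powr (- real DIM('a) / 2)) * ennreal (sqrt (2 * pi * t\<^sup>2) ^ DIM('a))"
    unfolding gauss_kernel_def int[symmetric]
    by (subst nn_integral_cmult[symmetric]) (simp_all add: ennreal_mult)
  ultimately show ?thesis
    by (simp flip: ennreal_mult)
qed

lemma nn_integral_reflect:
  fixes x :: "'a::euclidean_space"
  assumes [measurable]: "g \<in> borel_measurable borel"
  shows "(\<integral>\<^sup>+ y. g (x - y) \<partial>lborel) = (\<integral>\<^sup>+ y. g y \<partial>lborel)"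
  by (subst (2) lborel_affine[of "-1" x]) (simp_all add: density_1 nn_integral_distr)

lemma AE_lborel_reflect:
  fixes x :: "'a::euclidean_space"
  assumes "AE y in lborel. P y"
  shows "AE y in lborel. P (x - y)"
proof -
  obtain N where N: "{y. \<not> P y} \<subseteq> N" "N \<in> null_sets lborel"
    using assms by (auto simp: eventually_ae_filter)
  then have [measurable]: "N \<in> sets borel" by auto
  have "emeasure lborel {y. x - y \<in> N} = (\<integral>\<^sup>+ y. indicator N (x - y) \<partial>lborel)"
    by (subst nn_integral_indicator[symmetric])
      (auto simp del: nn_integral_indicator intro!: nn_integral_cong simp: indicator_def)
  also have "\<dots> = 0"
    using N by (subst nn_integral_reflect) auto
  finally have "{y. x - y \<in> N} \<in> null_sets lborel"
    by (auto simp: null_sets_def)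
  with N show ?thesis
    by (auto simp: eventually_ae_filter intro!: bexI[of _ "{y. x - y \<in> N}"])
qed

lemma gauss_op_eq:
  fixes f :: "'a::euclidean_space \<Rightarrow> real"
  assumes [measurable]: "f \<in> borel_measurable borel"
  shows "gauss_op t f x = (LINT y|lborel. gauss_kernel t y * f (x - y))"
  unfolding gauss_op_def gauss_kernel_def
  by (subst integral_completion) (simp_all add: mult.assoc)

lemma nn_integral_gauss_kernel_mult:
  fixes f :: "'a::euclidean_space \<Rightarrow> ennreal"
  assumes [measurable]: "f \<in> borel_measurable borel"
  shows "(\<integral>\<^sup>+ y. ennreal (gauss_kernel t y) * f (x - y) \<partial>lborel) = gauss_conv t f x"
  unfolding gauss_conv_def
  by (subst nn_integral_reflect[of _ x, symmetric]) simp_all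

lemma gauss_op_le_gauss_conv:
  fixes f :: "'a::euclidean_space \<Rightarrow> real"
  assumes [measurable]: "f \<in> borel_measurable borel"
  shows "ennreal \<bar>gauss_op t f x\<bar> \<le> gauss_conv t (\<lambda>y. ennreal \<bar>f y\<bar>) x"
proof (cases "integrable lborel (\<lambda>y. gauss_kernel t y * f (x - y))")
  case True
  have "ennreal \<bar>gauss_op t f x\<bar> \<le> (\<integral>\<^sup>+ y. norm (gauss_kernel t y * f (x - y)) \<partial>lborel)"
    using integral_norm_bound_ennreal[OF True] by (simp add: gauss_op_eq)
  also have "\<dots> = gauss_conv t (\<lambda>y. ennreal \<bar>f y\<bar>) x"
    by (subst nn_integral_gauss_kernel_mult[symmetric]) (simp_all add: abs_mult ennreal_mult)
  finally show ?thesis .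
next
  \<comment> \<open>Without integrability the Bochner integral is 0 by convention, and the bound is
    trivial.\<close>
  case False
  then show ?thesis by (simp add: gauss_op_eq not_integrable_integral_eq)
qed

text \<open>The two sides could differ only if the Tonelli integral were infinite, where the Bochner
  integral defaults to 0. For \<open>f\<close> in \<open>L^p\<close> this is excluded by
  \<open>f <= 1 + f powr p\<close>: the kernel has mass 1 and is bounded by its value at 0.\<close>

lemma gauss_op_eq_gauss_conv:
  fixes f :: "'a::euclidean_space \<Rightarrow> real"
  assumes [measurable]: "f \<in> borel_measurable borel" and nonneg: "\<And>x. 0 \<le> f x"
    and p: "1 \<le> p" and fin: "(\<integral>\<^sup>+ x. ennreal (f x powr p) \<partial>lborel) < \<infinity>" and t: "0 < t"
  shows "ennreal \<bar>gauss_op t f x\<bar> = gauss_conv t (\<lambda>y. ennreal (f y)) x"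
proof -
  have le: "f y \<le> 1 + f y powr p" for y
    using powr_mono[of 1 p "f y"] nonneg[of y] p powr_ge_zero[of "f y" p]
    by (cases "f y \<le> 1"; simp; linarith)
  have "gauss_conv t (\<lambda>y. ennreal (f y)) x
      \<le> (\<integral>\<^sup>+ y. ennreal (gauss_kernel t (x - y)) + ennreal (gauss_kernel t (0::'a)) * ennreal (f y powr p) \<partial>lborel)"
    unfolding gauss_conv_def
  proof (intro nn_integral_mono)
    fix y
    have "gauss_kernel t (x - y) * f y \<le> gauss_kernel t (x - y) * (1 + f y powr p)"
      by (intro mult_left_mono le) auto
    also have "\<dots> \<le> gauss_kernel t (x - y) + gauss_kernel t (0::'a) * f y powr p"
      using gauss_kernel_le[of t "x - y"] by (auto simp: distrib_left intro!: mult_right_mono)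
    finally show "ennreal (gauss_kernel t (x - y)) * ennreal (f y)
        \<le> ennreal (gauss_kernel t (x - y)) + ennreal (gauss_kernel t (0::'a)) * ennreal (f y powr p)"
      using nonneg by (simp flip: ennreal_mult ennreal_plus)
  qed
  also have "\<dots> = 1 + ennreal (gauss_kernel t (0::'a)) * (\<integral>\<^sup>+ y. ennreal (f y powr p) \<partial>lborel)"
    using nn_integral_gauss_kernel[OF t, where 'a='a]
      nn_integral_reflect[of "\<lambda>y. ennreal (gauss_kernel t y)" x]
    by (simp add: nn_integral_add nn_integral_cmult)
  also have "\<dots> < \<infinity>"
    using fin by (simp add: ennreal_mult_less_top)
  finally have fin': "gauss_conv t (\<lambda>y. ennreal (f y)) x < \<infinity>" .
  have "gauss_op t f x = enn2real (\<integral>\<^sup>+ y. ennreal (gauss_kernel t y * f (x - y)) \<partial>lborel)"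
    unfolding gauss_op_eq[OF assms(1)] using nonneg by (intro integral_eq_nn_integral) auto
  also have "\<dots> = enn2real (gauss_conv t (\<lambda>y. ennreal (f y)) x)"
    by (subst nn_integral_gauss_kernel_mult[symmetric]) (simp_all add: ennreal_mult nonneg)
  finally show ?thesis
    using fin' by simp
qed

text \<open>This allows a Lebesgue measurable function to be replaced by a Borel representative,
  simultaneously for every \<open>t\<close> and every \<open>x\<close>. The exceptional null set is
  merely reflected and translated.\<close>

lemma gauss_op_cong_AE:
  fixes f g :: "'a::euclidean_space \<Rightarrow> real"
  assumes "AE x in lborel. f x = g x"
    and [measurable]: "f \<in> borel_measurable lebesgue" "g \<in> borel_measurable borel"
  shows "gauss_op t f x = gauss_op t g x"
proof -
  have "(\<lambda>y. x - y) \<in> lebesgue \<rightarrow>\<^sub>M lebesgue"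
    using lebesgue_affine_measurable[of "\<lambda>_. -1" x]
    by (simp add: sum_negf euclidean_representation)
  from measurable_compose[OF this assms(2)]
  have m: "(\<lambda>y. f (x - y)) \<in> borel_measurable lebesgue" .
  have m': "(\<lambda>y. g (x - y)) \<in> borel_measurable lebesgue"
    by (intro measurable_completion) measurable
  have e: "(\<lambda>y. exp (- (norm y)\<^sup>2 / (2 * t\<^sup>2))) \<in> borel_measurable (lebesgue :: 'a measure)"
    by (intro measurable_completion) measurable
  have "AE y in lebesgue. f (x - y) = g (x - y)"
    by (rule AE_completion[OF AE_lborel_reflect[OF assms(1)]])
  then show ?thesis
    unfolding gauss_op_def
    by (intro arg_cong2[where f="(*)"] refl integral_cong_AE borel_measurable_times e m m')
      (auto elim: eventually_mono)
qed

section \<open>The best constant in terms of nonnegative Borel functions\<close>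

text \<open>The maximal inequality raised to the power \<open>p\<close>, so that no roots occur.
  Only nonnegative Borel functions are tested, and the integrals are over
  \<open>lborel\<close>.\<close>

definition gauss_admissible :: "'a::euclidean_space itself \<Rightarrow> real \<Rightarrow> ennreal \<Rightarrow> bool"
  where "gauss_admissible _ p C \<longleftrightarrow>
    (\<forall>f :: 'a \<Rightarrow> real. f \<in> borel_measurable borel \<longrightarrow> (\<forall>x. 0 \<le> f x) \<longrightarrow>
      (\<integral>\<^sup>+ x. ennreal (f x powr p) \<partial>lborel) < \<infinity> \<longrightarrow>
      (\<integral>\<^sup>+ x. ennreal_powr (gauss_sup (\<lambda>y. ennreal (f y)) x) p \<partial>lborel)
        \<le> ennreal_powr C p * (\<integral>\<^sup>+ x. ennreal (f x powr p) \<partial>lborel))"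

lemma gauss_admissibleD:
  fixes f :: "'a::euclidean_space \<Rightarrow> real"
  assumes "gauss_admissible TYPE('a) p C" "f \<in> borel_measurable borel" "\<And>x. 0 \<le> f x"
    "(\<integral>\<^sup>+ x. ennreal (f x powr p) \<partial>lborel) < \<infinity>"
  shows "(\<integral>\<^sup>+ x. ennreal_powr (gauss_sup (\<lambda>y. ennreal (f y)) x) p \<partial>lborel)
        \<le> ennreal_powr C p * (\<integral>\<^sup>+ x. ennreal (f x powr p) \<partial>lborel)"
  using assms unfolding gauss_admissible_def by blast

text \<open>Passing to p-th powers is an order isomorphism of [0, infinity], and completing the
  measure does not change the integral of any function. Arbitrary \<open>g\<close> is allowed so as
  to cover \<open>gauss_max f\<close> for Lebesgue measurable \<open>f\<close>.\<close>

lemma Lp_norm_le_iff: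
  fixes g h :: "'a::euclidean_space \<Rightarrow> ennreal"
  assumes p: "0 < p"
  shows "Lp_norm p g \<le> C * Lp_norm p h \<longleftrightarrow>
    (\<integral>\<^sup>+ x. ennreal_powr (g x) p \<partial>lborel) \<le> ennreal_powr C p * (\<integral>\<^sup>+ x. ennreal_powr (h x) p \<partial>lborel)"
  using p by (subst ennreal_powr_le_iff[of p, symmetric])
    (simp_all add: Lp_norm_def ennreal_powr_mult ennreal_powr_inverse' nn_integral_completion)

lemma Lp_norm_less_top_iff:
  fixes g :: "'a::euclidean_space \<Rightarrow> ennreal"
  shows "Lp_norm p g < top \<longleftrightarrow> (\<integral>\<^sup>+ x. ennreal_powr (g x) p \<partial>lborel) < top"
  by (simp add: Lp_norm_def ennreal_powr_def nn_integral_completion less_top)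

text \<open>Nonnegative Borel functions in \<open>L^p\<close> are among the original test functions,
  and for them the two maximal functions coincide. Conversely, a general \<open>f\<close> agrees
  almost everywhere with a Borel \<open>g\<close>, and its maximal function is at most that of the
  absolute value of \<open>g\<close>, which has the same norm.\<close>

lemma gauss_max_norm_eq:
  assumes p: "1 < p"
  shows "gauss_max_norm TYPE('a::euclidean_space) p = Inf {C. gauss_admissible TYPE('a) p C}"
proof -
  have "(\<forall>f \<in> (Lp_space p :: ('a \<Rightarrow> real) set).
      Lp_norm p (gauss_max f) \<le> C * Lp_norm p (\<lambda>x. ennreal \<bar>f x\<bar>)) \<longleftrightarrow> gauss_admissible TYPE('a) p C"
    (is "?L \<longleftrightarrow> ?R") for C
  proof
    assume L: ?L
    show ?R
      unfolding gauss_admissible_def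
    proof (intro allI impI)
      fix f :: "'a \<Rightarrow> real"
      assume f [measurable]: "f \<in> borel_measurable borel" and nonneg: "\<forall>x. 0 \<le> f x"
        and fin: "(\<integral>\<^sup>+ x. ennreal (f x powr p) \<partial>lborel) < \<infinity>"
      have "f \<in> Lp_space p"
        using fin nonneg measurable_completion[of f lborel borel]
        by (simp add: Lp_space_def Lp_norm_less_top_iff ennreal_powr_ennreal)
      moreover have "gauss_max f = gauss_sup (\<lambda>y. ennreal (f y))"
        unfolding gauss_max_def gauss_sup_def
        using nonneg p fin by (intro ext SUP_cong refl gauss_op_eq_gauss_conv[of f p]) auto
      ultimately show "(\<integral>\<^sup>+ x. ennreal_powr (gauss_sup (\<lambda>y. ennreal (f y)) x) p \<partial>lborel)
        \<le> ennreal_powr C p * (\<integral>\<^sup>+ x. ennreal (f x powr p) \<partial>lborel)"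
        using L p nonneg by (auto simp: Lp_norm_le_iff ennreal_powr_ennreal)
    qed
  next
    assume R: ?R
    show ?L
    proof
      fix f :: "'a \<Rightarrow> real"
      assume f: "f \<in> Lp_space p"
      then have fm: "f \<in> borel_measurable lebesgue"
        and fin: "(\<integral>\<^sup>+ x. ennreal (\<bar>f x\<bar> powr p) \<partial>lborel) < \<infinity>"
        by (simp_all add: Lp_space_def Lp_norm_less_top_iff ennreal_powr_ennreal)
      obtain g where g [measurable]: "g \<in> borel_measurable lborel" and eq: "AE x in lborel. f x = g x"
        using completion_ex_borel_measurable_real[OF fm] by blast
      have int: "(\<integral>\<^sup>+ x. ennreal (\<bar>f x\<bar> powr p) \<partial>lborel) = (\<integral>\<^sup>+ x. ennreal (\<bar>g x\<bar> powr p) \<partial>lborel)"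
        using eq by (intro nn_integral_cong_AE) (auto elim: eventually_mono)
      have "gauss_max f x \<le> gauss_sup (\<lambda>y. ennreal \<bar>g y\<bar>) x" for x
        unfolding gauss_max_def gauss_sup_def
      proof (intro SUP_mono bexI)
        fix t :: real
        show "ennreal \<bar>gauss_op t f x\<bar> \<le> gauss_conv t (\<lambda>y. ennreal \<bar>g y\<bar>) x"
          using g by (subst gauss_op_cong_AE[OF eq fm]) (auto intro: gauss_op_le_gauss_conv)
      qed
      then have "(\<integral>\<^sup>+ x. ennreal_powr (gauss_max f x) p \<partial>lborel)
          \<le> (\<integral>\<^sup>+ x. ennreal_powr (gauss_sup (\<lambda>y. ennreal \<bar>g y\<bar>) x) p \<partial>lborel)"
        using p by (intro nn_integral_mono ennreal_powr_mono) auto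
      also have "\<dots> \<le> ennreal_powr C p * (\<integral>\<^sup>+ x. ennreal (\<bar>g x\<bar> powr p) \<partial>lborel)"
        using fin int g by (intro gauss_admissibleD[OF R]) auto
      finally show "Lp_norm p (gauss_max f) \<le> C * Lp_norm p (\<lambda>x. ennreal \<bar>f x\<bar>)"
        using p by (simp add: Lp_norm_le_iff ennreal_powr_ennreal int)
    qed
  qed
  then show ?thesis by (simp add: gauss_max_norm_def)
qed

lemma gauss_max_norm_mono:
  assumes "1 < p"
    and "\<And>C. gauss_admissible TYPE('b::euclidean_space) p C \<Longrightarrow> gauss_admissible TYPE('a::euclidean_space) p C"
  shows "gauss_max_norm TYPE('a::euclidean_space) p \<le> gauss_max_norm TYPE('b::euclidean_space) p"
  using assms by (auto simp: gauss_max_norm_eq intro!: Inf_superset_mono)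

section \<open>Dependence on the dimension alone\<close>

text \<open>A bijection between the two orthonormal bases extends linearly. It relabels coordinates,
  hence preserves norms and the volume of boxes, and boxes determine Lebesgue measure. This links an
  arbitrary space of dimension d + 1 to the product \<open>'a * real\<close>, where the slab
  lives.\<close>

lemma exists_measure_preserving_isometry:
  assumes dim: "DIM('b::euclidean_space) = DIM('c::euclidean_space)"
  obtains T :: "'b::euclidean_space \<Rightarrow> 'c::euclidean_space"
    where "linear T" "\<And>z. norm (T z) = norm z" "distr lborel borel T = lborel"
proof -
  obtain \<beta> :: "'b \<Rightarrow> 'c" where \<beta>: "bij_betw \<beta> Basis Basis"
    using finite_same_card_bij[OF finite_Basis finite_Basis dim] by blast
  define T :: "'b \<Rightarrow> 'c" where "T z = (\<Sum>b\<in>Basis. (z \<bullet> b) *\<^sub>R \<beta> b)" for z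
  have \<beta>_mem: "\<beta> b \<in> Basis" if "b \<in> Basis" for b
    using \<beta> that by (auto simp: bij_betw_def)
  have \<beta>_inner: "\<beta> a \<bullet> \<beta> b = (if a = b then 1 else 0)" if "a \<in> Basis" "b \<in> Basis" for a b
    using \<beta> that \<beta>_mem by (auto simp: inner_Basis bij_betw_def inj_on_def)
  have T_inner: "T z \<bullet> \<beta> b = z \<bullet> b" if "b \<in> Basis" for z b
    using that by (simp add: T_def inner_sum_left \<beta>_inner if_distrib sum.If_cases cong: if_cong)
  have lin: "linear T"
    by (rule linearI) (simp_all add: T_def inner_add_left scaleR_add_left sum.distrib scaleR_sum_right)
  have meas [measurable]: "T \<in> borel_measurable borel"
    unfolding T_def by measurable
  have "norm (T z) = norm z" for z
  proof -
    have "T z \<bullet> T z = (\<Sum>c\<in>Basis. (T z \<bullet> c) * (T z \<bullet> c))"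
      by (rule euclidean_inner)
    also have "\<dots> = (\<Sum>b\<in>Basis. (T z \<bullet> \<beta> b) * (T z \<bullet> \<beta> b))"
      by (rule sum.reindex_bij_betw[OF \<beta>, symmetric])
    also have "\<dots> = z \<bullet> z"
      by (subst euclidean_inner[of z z]) (simp add: T_inner)
    finally show ?thesis by (simp add: norm_eq_sqrt_inner)
  qed
  moreover have "lborel = distr lborel borel T"
  proof (rule lborel_eqI)
    fix l u :: 'c
    assume lu: "\<And>b. b \<in> Basis \<Longrightarrow> l \<bullet> b \<le> u \<bullet> b"
    \<comment> \<open>\<open>S\<close> relabels coordinates backwards: it carries the corners of a
      box in \<open>'c\<close> to the corners of its preimage under \<open>T\<close>.\<close>
    define S where "S w = (\<Sum>b\<in>Basis. (w \<bullet> \<beta> b) *\<^sub>R b)" for w :: 'c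
    have S: "S w \<bullet> b = w \<bullet> \<beta> b" if "b \<in> Basis" for w b
      using that by (simp add: S_def inner_sum_left inner_Basis if_distrib sum.If_cases cong: if_cong)
    have ball: "(\<forall>c\<in>Basis. P c) \<longleftrightarrow> (\<forall>b\<in>Basis. P (\<beta> b))" for P
      unfolding bij_betw_imp_surj_on[OF \<beta>, symmetric] by simp
    have "T -` box l u = {z. \<forall>b\<in>Basis. l \<bullet> \<beta> b < T z \<bullet> \<beta> b \<and> T z \<bullet> \<beta> b < u \<bullet> \<beta> b}"
      unfolding box_def ball by auto
    also have "\<dots> = box (S l) (S u)"
      by (auto simp: box_def S T_inner)
    finally have "emeasure (distr lborel borel T) (box l u) = emeasure lborel (box (S l) (S u))"
      by (simp add: emeasure_distr)
    also have "\<dots> = ennreal (\<Prod>b\<in>Basis. (S u - S l) \<bullet> b)"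
      by (rule emeasure_lborel_box) (simp add: S lu \<beta>_mem)
    also have "(\<Prod>b\<in>Basis. (S u - S l) \<bullet> b) = (\<Prod>b\<in>Basis. (u - l) \<bullet> \<beta> b)"
      by (simp add: inner_diff_left S)
    also have "\<dots> = (\<Prod>c\<in>Basis. (u - l) \<bullet> c)"
      by (rule prod.reindex_bij_betw[OF \<beta>])
    finally show "emeasure (distr lborel borel T) (box l u) = ennreal (\<Prod>c\<in>Basis. (u - l) \<bullet> c)" .
  qed simp
  ultimately show ?thesis using lin by (intro that[of T]) auto
qed

text \<open>The kernel sees its argument only through the norm and the dimension. Averages, maximal
  functions and integrals of powers are therefore compatible with composition by the isometry
  \<open>T\<close>, and a test function \<open>f\<close> on \<open>'c\<close> is tested as
  \<open>f\<close> composed with \<open>T\<close> on \<open>'b\<close>.\<close>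

lemma gauss_max_norm_le_of_DIM_eq:
  assumes dim: "DIM('b::euclidean_space) = DIM('c::euclidean_space)" and p: "1 < p"
  shows "gauss_max_norm TYPE('c::euclidean_space) p \<le> gauss_max_norm TYPE('b::euclidean_space) p"
proof (rule gauss_max_norm_mono[OF p])
  fix C assume C: "gauss_admissible TYPE('b) p C"
  obtain T :: "'b \<Rightarrow> 'c" where T: "linear T" "\<And>z. norm (T z) = norm z" "distr lborel borel T = lborel"
    using exists_measure_preserving_isometry[OF dim] by metis
  have T_meas [measurable]: "T \<in> borel_measurable borel"
    using T(1) by (intro borel_measurable_continuous_onI linear_continuous_on linear_linear[THEN iffD2])
  have int_T: "(\<integral>\<^sup>+ z. g (T z) \<partial>lborel) = (\<integral>\<^sup>+ x. g x \<partial>lborel)"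
    if [measurable]: "g \<in> borel_measurable borel" for g
    using nn_integral_distr[of T lborel borel g] by (simp add: T(3))
  show "gauss_admissible TYPE('c) p C"
    unfolding gauss_admissible_def
  proof (intro allI impI)
    fix f :: "'c \<Rightarrow> real"
    assume f [measurable]: "f \<in> borel_measurable borel" and nonneg: "\<forall>x. 0 \<le> f x"
      and fin: "(\<integral>\<^sup>+ x. ennreal (f x powr p) \<partial>lborel) < \<infinity>"
    have kernel: "gauss_kernel t (z - w) = gauss_kernel t (T z - T w)" for t z w
      by (simp add: gauss_kernel_def dim linear_diff[OF T(1), symmetric] T(2))
    have "gauss_conv t (\<lambda>z. ennreal (f (T z))) z = gauss_conv t (\<lambda>x. ennreal (f x)) (T z)" for t z
      unfolding gauss_conv_def kernel by (rule int_T) measurable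
    then have sup: "gauss_sup (\<lambda>z. ennreal (f (T z))) z = gauss_sup (\<lambda>x. ennreal (f x)) (T z)" for z
      by (simp add: gauss_sup_def)
    have int: "(\<integral>\<^sup>+ z. ennreal (f (T z) powr p) \<partial>lborel) = (\<integral>\<^sup>+ x. ennreal (f x powr p) \<partial>lborel)"
      by (rule int_T[of "\<lambda>x. ennreal (f x powr p)"]) measurable
    have "(\<integral>\<^sup>+ x. ennreal_powr (gauss_sup (\<lambda>y. ennreal (f y)) x) p \<partial>lborel)
        = (\<integral>\<^sup>+ z. ennreal_powr (gauss_sup (\<lambda>z. ennreal (f (T z))) z) p \<partial>lborel)"
      unfolding sup by (rule int_T[symmetric]) measurable
    also have "\<dots> \<le> ennreal_powr C p * (\<integral>\<^sup>+ z. ennreal (f (T z) powr p) \<partial>lborel)"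
      using nonneg fin by (intro gauss_admissibleD[OF C]) (auto simp: int)
    finally show "(\<integral>\<^sup>+ x. ennreal_powr (gauss_sup (\<lambda>y. ennreal (f y)) x) p \<partial>lborel)
        \<le> ennreal_powr C p * (\<integral>\<^sup>+ x. ennreal (f x powr p) \<partial>lborel)"
      by (simp add: int)
  qed
qed

section \<open>Comparison of dimensions d and d + 1\<close>

lemma gauss_kernel_Pair:
  "gauss_kernel t (x, u) = gauss_kernel t x * gauss_kernel t (u::real)"
proof -
  have "- (norm (x, u))\<^sup>2 / (2 * t\<^sup>2) = - (norm x)\<^sup>2 / (2 * t\<^sup>2) + - (norm u)\<^sup>2 / (2 * t\<^sup>2)"
    by (simp add: norm_Pair diff_divide_distrib)
  moreover have "- real DIM('a \<times> real) / 2 = - real DIM('a) / 2 + - real DIM(real) / 2"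
    by (simp add: field_simps)
  ultimately show ?thesis
    unfolding gauss_kernel_def by (simp only: powr_add exp_add mult_ac)
qed

lemma nn_integral_lborel_Pair:
  fixes g :: "'a::euclidean_space \<times> real \<Rightarrow> ennreal"
  assumes [measurable]: "g \<in> borel_measurable borel"
  shows "(\<integral>\<^sup>+ z. g z \<partial>lborel) = (\<integral>\<^sup>+ x. \<integral>\<^sup>+ u. g (x, u) \<partial>lborel \<partial>lborel)"
proof -
  have "g \<in> borel_measurable (lborel \<Otimes>\<^sub>M lborel)"
    by (simp add: lborel_prod)
  from lborel.nn_integral_fst[OF this] show ?thesis
    by (simp add: lborel_prod)
qed

lemma gauss_conv_prod:
  fixes f :: "'a::euclidean_space \<Rightarrow> ennreal" and h :: "real \<Rightarrow> ennreal"
  assumes [measurable]: "f \<in> borel_measurable borel" "h \<in> borel_measurable borel"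
  shows "gauss_conv t (\<lambda>z. f (fst z) * h (snd z)) (x, u) = gauss_conv t f x * gauss_conv t h u"
proof -
  have [measurable]: "fst \<in> borel_measurable (borel :: ('a \<times> real) measure)"
    "snd \<in> borel_measurable (borel :: ('a \<times> real) measure)"
    by (auto intro!: borel_measurable_continuous_onI continuous_intros)
  have "gauss_conv t (\<lambda>z. f (fst z) * h (snd z)) (x, u)
    = (\<integral>\<^sup>+ y. \<integral>\<^sup>+ v. (ennreal (gauss_kernel t (x - y)) * f y) * (ennreal (gauss_kernel t (u - v)) * h v) \<partial>lborel \<partial>lborel)"
    unfolding gauss_conv_def
    by (subst nn_integral_lborel_Pair) (simp_all add: gauss_kernel_Pair ennreal_mult mult_ac)
  also have "\<dots> = (\<integral>\<^sup>+ y. (ennreal (gauss_kernel t (x - y)) * f y) * gauss_conv t h u \<partial>lborel)"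
    unfolding gauss_conv_def by (intro nn_integral_cong nn_integral_cmult) measurable
  also have "\<dots> = gauss_conv t f x * gauss_conv t h u"
    unfolding gauss_conv_def by (intro nn_integral_multc) measurable
  finally show ?thesis .
qed

text \<open>The substitution \<open>y = u - t * z\<close> moves the time into the argument of
  \<open>h\<close>. The kernel is then fixed and can serve as a dominating function for bounded
  \<open>h\<close>.\<close>

lemma gauss_conv_real_rescale:
  fixes h :: "real \<Rightarrow> ennreal"
  assumes [measurable]: "h \<in> borel_measurable borel" and t: "0 < t"
  shows "gauss_conv t h u = (\<integral>\<^sup>+ z. ennreal (gauss_kernel 1 z) * h (u - t * z) \<partial>lborel)"
proof -
  have "t * gauss_kernel t (t * z) = gauss_kernel 1 z" for z :: real
  proof -
    have "(2 * pi * t\<^sup>2) powr (- 1 / 2) * t = (2 * pi) powr (- 1 / 2)"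
      using t by (simp add: powr_mult powr_minus powr_half_sqrt real_sqrt_mult)
    then show ?thesis
      using t by (simp add: gauss_kernel_def power_mult_distrib mult_ac)
  qed
  then have eq: "ennreal t * ennreal (gauss_kernel t (t * z)) = ennreal (gauss_kernel 1 z)" for z :: real
    using t by (simp flip: ennreal_mult)
  have "gauss_conv t h u = ennreal t * (\<integral>\<^sup>+ z. ennreal (gauss_kernel t (t * z)) * h (u - t * z) \<partial>lborel)"
    unfolding gauss_conv_def
    using t by (subst nn_integral_real_affine[of _ "- t" u]) simp_all
  also have "\<dots> = (\<integral>\<^sup>+ z. ennreal t * (ennreal (gauss_kernel t (t * z)) * h (u - t * z)) \<partial>lborel)"
    by (subst nn_integral_cmult) simp_all
  also have "\<dots> = (\<integral>\<^sup>+ z. ennreal (gauss_kernel 1 z) * h (u - t * z) \<partial>lborel)"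
    by (simp add: mult.assoc[symmetric] eq)
  finally show ?thesis .
qed

text \<open>An interior point stays inside the interval under small shifts, so dominated convergence
  applies. The sequence \<open>r\<close> is left general: it is \<open>t / N n\<close> for the slab
  and \<open>1 / Suc n\<close> for the lower bound 1.\<close>

lemma gauss_conv_indicator_tendsto:
  fixes u :: real
  assumes r: "r \<longlonglongrightarrow> 0" and u: "\<bar>u\<bar> < 1"
  shows "(\<lambda>n. \<integral>\<^sup>+ z. ennreal (gauss_kernel 1 z) * indicator {-1<..<1} (u - r n * z) \<partial>lborel) \<longlonglongrightarrow> 1"
proof -
  have "(\<lambda>n. \<integral>\<^sup>+ z. ennreal (gauss_kernel 1 z) * indicator {-1<..<1} (u - r n * z) \<partial>lborel)
      \<longlonglongrightarrow> (\<integral>\<^sup>+ z. ennreal (gauss_kernel 1 z) \<partial>(lborel :: real measure))"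
  proof (rule nn_integral_dominated_convergence[where w="\<lambda>z. ennreal (gauss_kernel 1 z)"])
    show "AE z in lborel. (\<lambda>n. ennreal (gauss_kernel 1 z) * indicator {-1<..<1} (u - r n * z))
        \<longlonglongrightarrow> ennreal (gauss_kernel 1 z)"
    proof (rule AE_I2)
      fix z :: real
      have "(\<lambda>n. u - r n * z) \<longlonglongrightarrow> u - 0 * z"
        by (intro tendsto_intros r)
      then have "\<forall>\<^sub>F n in sequentially. u - r n * z \<in> {-1<..<1}"
        using u by (intro topological_tendstoD) auto
      then have "\<forall>\<^sub>F n in sequentially. ennreal (gauss_kernel 1 z) * indicator {-1<..<1} (u - r n * z)
          = ennreal (gauss_kernel 1 z)"
        by eventually_elim simp
      then show "(\<lambda>n. ennreal (gauss_kernel 1 z) * indicator {-1<..<1} (u - r n * z))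
          \<longlonglongrightarrow> ennreal (gauss_kernel 1 z)"
        by (rule tendsto_eventually)
    qed
  qed (use nn_integral_gauss_kernel[of 1, where 'a=real] in \<open>auto simp: indicator_def\<close>)
  then show ?thesis by (simp add: nn_integral_gauss_kernel)
qed

lemma gauss_admissible_slice:
  assumes p: "1 < p" and C: "gauss_admissible TYPE('a::euclidean_space \<times> real) p C"
  shows "gauss_admissible TYPE('a::euclidean_space) p C"
  unfolding gauss_admissible_def
proof (intro allI impI)
  fix f :: "'a \<Rightarrow> real"
  assume f [measurable]: "f \<in> borel_measurable borel" and nonneg: "\<forall>x. 0 \<le> f x"
    and fin: "(\<integral>\<^sup>+ x. ennreal (f x powr p) \<partial>lborel) < \<infinity>"
  have fst_snd [measurable]: "fst \<in> borel_measurable (borel :: ('a \<times> real) measure)"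
    "snd \<in> borel_measurable (borel :: ('a \<times> real) measure)"
    by (auto intro!: borel_measurable_continuous_onI continuous_intros)
  define I where "I = (\<integral>\<^sup>+ x. ennreal (f x powr p) \<partial>lborel)"
  define N :: "nat \<Rightarrow> real" where "N n = real (Suc n)" for n
  have N: "0 < N n" for n by (simp add: N_def)
  define F where "F n z = f (fst z) * indicator {- N n<..<N n} (snd z)" for n and z :: "'a \<times> real"
  define S where "S n = gauss_sup (\<lambda>z. ennreal (F n z))" for n
  have [measurable]: "F n \<in> borel_measurable borel" for n
    unfolding F_def by measurable
  have [measurable]: "S n \<in> borel_measurable borel" for n
    unfolding S_def by measurable
  have [measurable]: "gauss_sup (\<lambda>y. ennreal (f y)) \<in> borel_measurable borel"
    by measurable
  have F_int: "(\<integral>\<^sup>+ z. ennreal (F n z powr p) \<partial>lborel) = I * ennreal (2 * N n)" for n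
  proof -
    have "ennreal (F n (x, u) powr p) = ennreal (f x powr p) * indicator {- N n<..<N n} u" for x u
      using p by (auto simp: F_def indicator_def)
    then show ?thesis
      using N[of n] unfolding I_def
      by (subst nn_integral_lborel_Pair) (simp_all add: nn_integral_cmult nn_integral_multc)
  qed
  have S_int: "(\<integral>\<^sup>+ z. ennreal_powr (S n z) p \<partial>lborel) \<le> ennreal_powr C p * (I * ennreal (2 * N n))" for n
  proof -
    have "(\<integral>\<^sup>+ z. ennreal (F n z powr p) \<partial>lborel) < \<infinity>"
      unfolding F_int using fin by (simp add: I_def ennreal_mult_less_top)
    moreover have "0 \<le> F n z" for z
      using nonneg by (simp add: F_def)
    ultimately show ?thesis
      unfolding S_def F_int[symmetric] by (intro gauss_admissibleD[OF C]) auto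
  qed
  \<comment> \<open>Substituting \<open>N n * u\<close> for the last variable produces the factor
    \<open>N n\<close>, which also appears in the norm of \<open>F n\<close>. After cancellation the
    bound is independent of \<open>n\<close>, as Fatou's lemma requires.\<close>
  have S_scaled: "(\<integral>\<^sup>+ x. \<integral>\<^sup>+ u. ennreal_powr (S n (x, N n * u)) p * indicator {-1<..<1} u \<partial>lborel \<partial>lborel)
      \<le> ennreal_powr C p * I * 2" for n
  proof -
    have "ennreal (N n) * (\<integral>\<^sup>+ x. \<integral>\<^sup>+ u. ennreal_powr (S n (x, N n * u)) p * indicator {-1<..<1} u \<partial>lborel \<partial>lborel)
      \<le> ennreal (N n) * (\<integral>\<^sup>+ x. \<integral>\<^sup>+ u. ennreal_powr (S n (x, N n * u)) p \<partial>lborel \<partial>lborel)"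
      by (intro mult_left_mono nn_integral_mono) (auto simp: indicator_def)
    also have "\<dots> = (\<integral>\<^sup>+ x. ennreal (N n) * (\<integral>\<^sup>+ u. ennreal_powr (S n (x, N n * u)) p \<partial>lborel) \<partial>lborel)"
      by (subst nn_integral_cmult) simp_all
    also have "\<dots> = (\<integral>\<^sup>+ x. (\<integral>\<^sup>+ u. ennreal_powr (S n (x, u)) p \<partial>lborel) \<partial>lborel)"
      using N[of n] by (intro nn_integral_cong) (subst (2) nn_integral_real_affine[of _ "N n" 0], simp_all)
    also have "\<dots> = (\<integral>\<^sup>+ z. ennreal_powr (S n z) p \<partial>lborel)"
      by (subst nn_integral_lborel_Pair) simp_all
    also have "\<dots> \<le> ennreal (N n) * (ennreal_powr C p * I * 2)"
      using S_int[of n] N[of n] by (simp add: ennreal_mult mult_ac)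
    finally show ?thesis
      using N[of n] by (subst (asm) ennreal_mult_le_mult_iff) auto
  qed
  have liminf_S: "ennreal_powr (gauss_sup (\<lambda>y. ennreal (f y)) x) p \<le> liminf (\<lambda>n. ennreal_powr (S n (x, N n * u)) p)"
    (is "_ \<le> ?L") if u: "\<bar>u\<bar> < 1" for x u
  proof -
    \<comment> \<open>The limit in \<open>n\<close> is not uniform in \<open>t\<close>, so the bound
      is shown for each \<open>t\<close> separately. It is stated with a p-th root to permit taking
      the supremum afterwards.\<close>
    have "gauss_conv t (\<lambda>y. ennreal (f y)) x \<le> ennreal_powr ?L (1 / p)" if t: "0 < t" for t
    proof -
      let ?c = "gauss_conv t (\<lambda>y. ennreal (f y)) x"
      define w where "w n = (\<integral>\<^sup>+ z. ennreal (gauss_kernel 1 z) * indicator {-1<..<1} (u - t / N n * z) \<partial>lborel)" for n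
      have "(\<lambda>n. t / N n) \<longlonglongrightarrow> 0"
        unfolding N_def by real_asymp
      then have "w \<longlonglongrightarrow> 1"
        unfolding w_def by (rule gauss_conv_indicator_tendsto[OF _ u])
      \<comment> \<open>The average \<open>?c\<close> may be infinite here; the product still
        converges because the other factor tends to 1 and not to 0.\<close>
      then have "(\<lambda>n. ennreal_powr ?c p * ennreal_powr (w n) p) \<longlonglongrightarrow> ennreal_powr ?c p * 1"
        by (intro tendsto_mult_ennreal tendsto_const tendsto_ennreal_powr_1) auto
      then have "ennreal_powr ?c p = liminf (\<lambda>n. ennreal_powr ?c p * ennreal_powr (w n) p)"
        by (subst lim_imp_Liminf) auto
      also have "\<dots> \<le> ?L"
      proof (intro Liminf_mono always_eventually allI)
        fix n
        have "gauss_conv t (\<lambda>z. ennreal (F n z)) (x, N n * u)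
            = ?c * gauss_conv t (indicator {- N n<..<N n}) (N n * u)"
          using nonneg by (subst gauss_conv_prod[symmetric])
            (auto simp: F_def ennreal_mult' ennreal_indicator)
        \<comment> \<open>Division by \<open>N n\<close> turns the slab of half-width
          \<open>N n\<close> at time \<open>t\<close> into the unit interval at time
          \<open>t / N n\<close>.\<close>
        also have "gauss_conv t (indicator {- N n<..<N n}) (N n * u) = w n"
        proof -
          have "indicator {- N n<..<N n} (N n * u - t * z) = (indicator {-1<..<1} (u - t / N n * z) :: ennreal)" for z
            using N[of n] by (auto simp: indicator_def field_simps)
          then show ?thesis
            unfolding w_def by (subst gauss_conv_real_rescale) (use t in auto)
        qed
        finally have "?c * w n \<le> S n (x, N n * u)"
          using t unfolding S_def gauss_sup_def by (metis SUP_upper greaterThan_iff)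
        then show "ennreal_powr ?c p * ennreal_powr (w n) p \<le> ennreal_powr (S n (x, N n * u)) p"
          using p by (simp add: ennreal_powr_mono flip: ennreal_powr_mult)
      qed
      finally show ?thesis
        using p ennreal_powr_mono[of "1 / p" "ennreal_powr ?c p" ?L] by (simp add: ennreal_powr_inverse)
    qed
    then have "gauss_sup (\<lambda>y. ennreal (f y)) x \<le> ennreal_powr ?L (1 / p)"
      by (auto simp: gauss_sup_def intro!: SUP_least)
    then show ?thesis
      using p ennreal_powr_mono[of p _ "ennreal_powr ?L (1 / p)"] by (simp add: ennreal_powr_inverse')
  qed
  \<comment> \<open>The factor 2 is the length of the interval (-1, 1). Fatou's lemma is used twice,
    first in \<open>u\<close> and then in \<open>x\<close>.\<close>
  have "(\<integral>\<^sup>+ x. ennreal_powr (gauss_sup (\<lambda>y. ennreal (f y)) x) p \<partial>lborel) * 2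
      = (\<integral>\<^sup>+ x. \<integral>\<^sup>+ u. ennreal_powr (gauss_sup (\<lambda>y. ennreal (f y)) x) p * indicator {-1<..<1::real} u \<partial>lborel \<partial>lborel)"
    by (simp add: nn_integral_cmult nn_integral_multc)
  also have "\<dots> \<le> (\<integral>\<^sup>+ x. \<integral>\<^sup>+ u. liminf (\<lambda>n. ennreal_powr (S n (x, N n * u)) p * indicator {-1<..<1} u) \<partial>lborel \<partial>lborel)"
    using liminf_S by (intro nn_integral_mono) (auto simp: indicator_def abs_less_iff Liminf_const)
  also have "\<dots> \<le> (\<integral>\<^sup>+ x. liminf (\<lambda>n. \<integral>\<^sup>+ u. ennreal_powr (S n (x, N n * u)) p * indicator {-1<..<1} u \<partial>lborel) \<partial>lborel)"
    by (intro nn_integral_mono nn_integral_liminf) measurable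
  also have "\<dots> \<le> liminf (\<lambda>n. \<integral>\<^sup>+ x. \<integral>\<^sup>+ u. ennreal_powr (S n (x, N n * u)) p * indicator {-1<..<1} u \<partial>lborel \<partial>lborel)"
    by (intro nn_integral_liminf) measurable
  also have "\<dots> \<le> liminf (\<lambda>n. ennreal_powr C p * I * 2)"
    by (intro Liminf_mono always_eventually allI S_scaled)
  also have "\<dots> = (ennreal_powr C p * I) * 2"
    by (simp add: Liminf_const)
  finally have "2 * (\<integral>\<^sup>+ x. ennreal_powr (gauss_sup (\<lambda>y. ennreal (f y)) x) p \<partial>lborel) \<le> 2 * (ennreal_powr C p * I)"
    by (simp add: mult.commute)
  then show "(\<integral>\<^sup>+ x. ennreal_powr (gauss_sup (\<lambda>y. ennreal (f y)) x) p \<partial>lborel)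
      \<le> ennreal_powr C p * (\<integral>\<^sup>+ x. ennreal (f x powr p) \<partial>lborel)"
    unfolding I_def by (subst (asm) ennreal_mult_le_mult_iff) auto
qed

lemma gauss_max_norm_dim_step:
  assumes "DIM('b::euclidean_space) = DIM('a::euclidean_space) + 1" and p: "1 < p"
  shows "gauss_max_norm TYPE('a::euclidean_space) p \<le> gauss_max_norm TYPE('b::euclidean_space) p"
proof -
  have "gauss_max_norm TYPE('a) p \<le> gauss_max_norm TYPE('a \<times> real) p"
    by (rule gauss_max_norm_mono[OF p gauss_admissible_slice[OF p]])
  also have "\<dots> \<le> gauss_max_norm TYPE('b) p"
    using assms by (intro gauss_max_norm_le_of_DIM_eq) auto
  finally show ?thesis .
qed

section \<open>Lower bounds in dimension one\<close>

lemma nn_integral_fold: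
  fixes g :: "real \<Rightarrow> ennreal"
  assumes [measurable]: "g \<in> borel_measurable borel"
  shows "(\<integral>\<^sup>+ x. g x \<partial>lborel) = (\<integral>\<^sup>+ x. (g x + g (- x)) * indicator {0<..} x \<partial>lborel)"
proof -
  have "(\<integral>\<^sup>+ x. g x \<partial>lborel) = (\<integral>\<^sup>+ x. g x * indicator {0<..} x + g x * indicator {..<0} x \<partial>lborel)"
  proof (rule nn_integral_cong_AE)
    show "AE x in lborel. g x = g x * indicator {0<..} x + g x * indicator {..<0} x"
      using AE_lborel_singleton[of "0::real"] by eventually_elim (auto simp: indicator_def)
  qed
  also have "\<dots> = (\<integral>\<^sup>+ x. g x * indicator {0<..} x \<partial>lborel) + (\<integral>\<^sup>+ x. g x * indicator {..<0} x \<partial>lborel)"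
    by (intro nn_integral_add) measurable
  also have "(\<integral>\<^sup>+ x. g x * indicator {..<0} x \<partial>lborel) = (\<integral>\<^sup>+ x. g (- x) * indicator {0<..} x \<partial>lborel)"
    by (subst nn_integral_real_affine[of _ "-1" 0]) (auto intro!: nn_integral_cong simp: indicator_def)
  also have "(\<integral>\<^sup>+ x. g x * indicator {0<..} x \<partial>lborel) + \<dots> = (\<integral>\<^sup>+ x. (g x + g (- x)) * indicator {0<..} x \<partial>lborel)"
    by (subst nn_integral_add[symmetric]) (auto simp: distrib_right)
  finally show ?thesis .
qed

lemma nn_integral_powr_from_0:
  fixes a :: real
  assumes "- 1 < a"
  shows "(\<integral>\<^sup>+ x. ennreal (x powr a) * indicator {0..1} x \<partial>lborel) = ennreal (1 / (a + 1))"
  using has_integral_powr_from_0[OF assms, of 1] by (intro nn_integral_has_integral_lebesgue') auto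

text \<open>Only even powers occur in the series, so all terms are nonnegative and the first two
  nonzero coefficients give a lower bound.\<close>

lemma cosh_ge_quadratic: "1 + x\<^sup>2 / 2 \<le> cosh (x::real)"
proof -
  let ?c = "\<lambda>n. if even n then x ^ n /\<^sub>R fact n else 0"
  have "1 + x\<^sup>2 / 2 = sum ?c {0, 2}"
    by simp
  also have "\<dots> \<le> suminf ?c"
    by (rule sum_le_suminf) (auto intro: sums_summable[OF cosh_converges] zero_le_even_power)
  also have "suminf ?c = cosh x"
    using sums_unique[OF cosh_converges] by metis
  finally show ?thesis .
qed

text \<open>
  The bracket is \<open>\<integral> u\<^sup>-\<^sup>s (1 - u\<^sup>4 / 4) du\<close> over \<open>[0, 1]\<close>, where
  \<open>1 - u\<^sup>4 / 4 = (1 - u\<^sup>2 / 2) (1 + u\<^sup>2 / 2)\<close> bounds \<open>exp (- u\<^sup>2 / 2) cosh u\<close> from below.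
\<close>

definition gauss_power_const :: "real \<Rightarrow> real"
  where "gauss_power_const s = 2 * exp (- 1 / 2) / sqrt (2 * pi) * (1 / (1 - s) - 1 / (4 * (5 - s)))"

lemma gauss_kernel_1_real: "gauss_kernel 1 z = exp (- z\<^sup>2 / 2) / sqrt (2 * pi)" for z :: real
  unfolding gauss_kernel_def by (simp add: powr_minus powr_half_sqrt) algebra

text \<open>Folding the line at 0 replaces the kernel by the sum of its values at
  \<open>1 - u\<close> and \<open>1 + u\<close>, which equals
  \<open>k * exp (- u^2 / 2) * cosh u\<close>. A polynomial lower bound for it makes the integral
  against the power explicit.\<close>

lemma gauss_power_lower_bound:
  assumes s: "0 < s" "s < 1"
  shows "ennreal (gauss_power_const s)
    \<le> (\<integral>\<^sup>+ u. ennreal (gauss_kernel 1 (1 - u)) * ennreal (\<bar>u\<bar> powr (- s) * indicator {-1..1} u) \<partial>lborel)"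
proof -
  define k where "k = 2 * exp (- 1 / 2) / sqrt (2 * pi)"
  have k: "0 \<le> k" by (simp add: k_def)
  have pw: "k * (1 - u ^ 4 / 4) \<le> gauss_kernel 1 (1 - u) + gauss_kernel 1 (1 + u)" if u: "0 \<le> u" "u \<le> 1" for u :: real
  proof -
    have u2: "u\<^sup>2 \<le> 1" using u by (simp add: power_le_one)
    have "1 - u ^ 4 / 4 = (1 - u\<^sup>2 / 2) * (1 + u\<^sup>2 / 2)"
      by (simp add: algebra_simps power2_eq_square power4_eq_xxxx)
    also have "\<dots> \<le> exp (- u\<^sup>2 / 2) * cosh u"
      using exp_ge_add_one_self[of "- u\<^sup>2 / 2"] cosh_ge_quadratic[of u] u2
      by (intro mult_mono) auto
    finally have "k * (1 - u ^ 4 / 4) \<le> k * (exp (- u\<^sup>2 / 2) * cosh u)"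
      using k by (rule mult_left_mono)
    also have "\<dots> = (exp (- 1 / 2) * exp (- u\<^sup>2 / 2) * exp u + exp (- 1 / 2) * exp (- u\<^sup>2 / 2) * exp (- u)) / sqrt (2 * pi)"
      by (simp add: k_def cosh_def algebra_simps add_divide_distrib)
    also have "exp (- 1 / 2) * exp (- u\<^sup>2 / 2) * exp u = exp (- (1 - u)\<^sup>2 / 2)"
    proof -
      have "- 1 / 2 + - u\<^sup>2 / 2 + u = - (1 - u)\<^sup>2 / 2"
        by (simp add: power2_eq_square algebra_simps add_divide_distrib diff_divide_distrib)
      then show ?thesis by (simp only: exp_add[symmetric])
    qed
    also have "exp (- 1 / 2) * exp (- u\<^sup>2 / 2) * exp (- u) = exp (- (1 + u)\<^sup>2 / 2)"
    proof -
      have "- 1 / 2 + - u\<^sup>2 / 2 + - u = - (1 + u)\<^sup>2 / 2"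
        by (simp add: power2_eq_square algebra_simps add_divide_distrib diff_divide_distrib)
      then show ?thesis by (simp only: exp_add[symmetric])
    qed
    also have "(exp (- (1 - u)\<^sup>2 / 2) + exp (- (1 + u)\<^sup>2 / 2)) / sqrt (2 * pi)
        = gauss_kernel 1 (1 - u) + gauss_kernel 1 (1 + u)"
      by (simp add: gauss_kernel_1_real add_divide_distrib)
    finally show ?thesis .
  qed
  have i0: "((\<lambda>u. u powr (- s)) has_integral 1 / (1 - s)) {0..1}"
    using has_integral_powr_from_0[of "- s" 1] s by simp
  have i4: "((\<lambda>u. u powr (4 - s)) has_integral 1 / (5 - s)) {0..1}"
    using has_integral_powr_from_0[of "4 - s" 1] s by simp
  have "((\<lambda>u. k * (u powr (- s) - u powr (4 - s) / 4)) has_integral k * (1 / (1 - s) - 1 / (5 - s) / 4)) {0..1}"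
    by (intro has_integral_mult_right has_integral_diff i0 has_integral_divide i4)
  then have "((\<lambda>u. k * (1 - u ^ 4 / 4) * u powr (- s)) has_integral k * (1 / (1 - s) - 1 / (5 - s) / 4)) {0..1}"
  proof (rule has_integral_eq[rotated])
    fix u :: real assume "u \<in> {0..1}"
    then show "k * (u powr (- s) - u powr (4 - s) / 4) = k * (1 - u ^ 4 / 4) * u powr (- s)"
      \<comment> \<open>At 0 both sides vanish because \<open>0 powr a = 0\<close>.\<close>
      by (cases "u = 0") (auto simp: powr_diff powr_minus powr_numeral field_simps)
  qed
  moreover have "k * (1 / (1 - s) - 1 / (5 - s) / 4) = gauss_power_const s"
    by (simp add: gauss_power_const_def k_def)
  ultimately have int: "((\<lambda>u. k * (1 - u ^ 4 / 4) * u powr (- s)) has_integral gauss_power_const s) {0..1}"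
    by simp
  have "0 \<le> k * (1 - u ^ 4 / 4) * u powr (- s)" if "u \<in> {0..1}" for u
    using k that power_le_one[of u 4] by auto
  with int have "ennreal (gauss_power_const s)
      = (\<integral>\<^sup>+ u. ennreal (k * (1 - u ^ 4 / 4) * u powr (- s)) * indicator {0..1} u \<partial>lborel)"
    by (subst nn_integral_has_integral_lebesgue'[of "{0..1}"]) auto
  also have "\<dots> \<le> (\<integral>\<^sup>+ u. (ennreal (gauss_kernel 1 (1 - u)) * ennreal (\<bar>u\<bar> powr (- s) * indicator {-1..1} u)
      + ennreal (gauss_kernel 1 (1 - (- u))) * ennreal (\<bar>- u\<bar> powr (- s) * indicator {-1..1} (- u))) * indicator {0<..} u \<partial>lborel)"
  proof (intro nn_integral_mono)
    fix u :: real
    show "ennreal (k * (1 - u ^ 4 / 4) * u powr (- s)) * indicator {0..1} u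
      \<le> (ennreal (gauss_kernel 1 (1 - u)) * ennreal (\<bar>u\<bar> powr (- s) * indicator {-1..1} u)
      + ennreal (gauss_kernel 1 (1 - (- u))) * ennreal (\<bar>- u\<bar> powr (- s) * indicator {-1..1} (- u))) * indicator {0<..} u"
    proof (cases "0 < u \<and> u \<le> 1")
      case True
      then have "k * (1 - u ^ 4 / 4) * u powr (- s) \<le> (gauss_kernel 1 (1 - u) + gauss_kernel 1 (1 + u)) * u powr (- s)"
        by (intro mult_right_mono pw) auto
      then show ?thesis
        using True by (simp add: distrib_right flip: ennreal_mult ennreal_plus)
    qed (auto simp: indicator_def)
  qed
  also have "\<dots> = (\<integral>\<^sup>+ u. ennreal (gauss_kernel 1 (1 - u)) * ennreal (\<bar>u\<bar> powr (- s) * indicator {-1..1} u) \<partial>lborel)"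
    by (rule nn_integral_fold[symmetric]) measurable
  finally show ?thesis .
qed

text \<open>At \<open>t = \<bar>x\<bar>\<close> the lower bound only uses the values of the power on \<open>[-\<bar>x\<bar>, \<bar>x\<bar>]\<close>,
  so the truncation does no harm.\<close>

lemma gauss_sup_power_ge:
  fixes x :: real
  assumes s: "0 < s" "s < 1" and x: "x \<noteq> 0" "\<bar>x\<bar> \<le> 1"
  shows "ennreal (gauss_power_const s) * ennreal (\<bar>x\<bar> powr (- s))
    \<le> gauss_sup (\<lambda>y. ennreal (\<bar>y\<bar> powr (- s) * indicator {-1..1} y)) x"
proof -
  let ?f = "\<lambda>y::real. ennreal (\<bar>y\<bar> powr (- s) * indicator {-1..1} y)"
  \<comment> \<open>This is the scaling behind the substitution \<open>y = x * u\<close>, which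
    sends the point \<open>x\<close> at time \<open>\<bar>x\<bar>\<close> to the point 1 at time 1.
    Since \<open>x\<close> may be negative, the Jacobian is \<open>\<bar>x\<bar>\<close>.\<close>
  have kernel: "\<bar>x\<bar> * gauss_kernel \<bar>x\<bar> (x - x * u) = gauss_kernel 1 (1 - u)" for u
  proof -
    have scale: "(2 * pi * x\<^sup>2) powr (- 1 / 2) * \<bar>x\<bar> = (2 * pi) powr (- 1 / 2)"
      using x by (simp add: powr_mult powr_minus powr_half_sqrt real_sqrt_mult)
    have "(x - x * u)\<^sup>2 = x\<^sup>2 * (1 - u)\<^sup>2"
      by (simp add: power2_eq_square algebra_simps)
    then have arg: "(x - x * u)\<^sup>2 / (2 * x\<^sup>2) = (1 - u)\<^sup>2 / 2"
      using x by simp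
    have "\<bar>x\<bar> * gauss_kernel \<bar>x\<bar> (x - x * u)
        = ((2 * pi * x\<^sup>2) powr (- 1 / 2) * \<bar>x\<bar>) * exp (- ((x - x * u)\<^sup>2 / (2 * x\<^sup>2)))"
      by (simp add: gauss_kernel_def)
    also have "\<dots> = gauss_kernel 1 (1 - u)"
      unfolding scale arg by (simp add: gauss_kernel_def)
    finally show ?thesis .
  qed
  have "ennreal (gauss_power_const s) * ennreal (\<bar>x\<bar> powr (- s))
    \<le> (\<integral>\<^sup>+ u. ennreal (gauss_kernel 1 (1 - u)) * ?f u \<partial>lborel) * ennreal (\<bar>x\<bar> powr (- s))"
    by (intro mult_right_mono gauss_power_lower_bound s) auto
  also have "\<dots> = (\<integral>\<^sup>+ u. ennreal (gauss_kernel 1 (1 - u)) * ?f u * ennreal (\<bar>x\<bar> powr (- s)) \<partial>lborel)"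
    by (subst nn_integral_multc) simp_all
  also have "\<dots> \<le> (\<integral>\<^sup>+ u. ennreal \<bar>x\<bar> * (ennreal (gauss_kernel \<bar>x\<bar> (x - x * u)) * ?f (x * u)) \<partial>lborel)"
  proof (intro nn_integral_mono)
    fix u :: real
    have "\<bar>u\<bar> powr (- s) * indicator {-1..1} u * \<bar>x\<bar> powr (- s) \<le> \<bar>x * u\<bar> powr (- s) * indicator {-1..1} (x * u)"
    proof (cases "\<bar>u\<bar> \<le> 1")
      case True
      then have "\<bar>x * u\<bar> \<le> 1"
        using x by (simp add: abs_mult mult_le_one)
      with True have "u \<in> {-1..1}" "x * u \<in> {-1..1}" by (auto simp: abs_le_iff)
      then show ?thesis
        by (simp add: abs_mult powr_mult mult.commute)
    qed (auto simp: indicator_def)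
    then have "gauss_kernel 1 (1 - u) * (\<bar>u\<bar> powr (- s) * indicator {-1..1} u * \<bar>x\<bar> powr (- s))
        \<le> gauss_kernel 1 (1 - u) * (\<bar>x * u\<bar> powr (- s) * indicator {-1..1} (x * u))"
      by (rule mult_left_mono) simp
    then show "ennreal (gauss_kernel 1 (1 - u)) * ?f u * ennreal (\<bar>x\<bar> powr (- s))
        \<le> ennreal \<bar>x\<bar> * (ennreal (gauss_kernel \<bar>x\<bar> (x - x * u)) * ?f (x * u))"
      by (simp add: kernel[symmetric] mult.assoc flip: ennreal_mult)
  qed
  also have "\<dots> = gauss_conv \<bar>x\<bar> ?f x"
    unfolding gauss_conv_def
    using x by (subst (2) nn_integral_real_affine[of _ x 0]) (simp_all add: nn_integral_cmult)
  also have "\<dots> \<le> gauss_sup ?f x"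
    unfolding gauss_sup_def using x by (intro SUP_upper) auto
  finally show ?thesis .
qed

text \<open>The condition \<open>s * p < 1\<close> makes the p-th power of the truncated function
  integrable. Its maximal function is at least \<open>gauss_power_const s\<close> times the function
  itself, so the common integral \<open>I\<close>, positive and finite, cancels.\<close>

lemma gauss_admissible_ge_power_const:
  assumes p: "1 < p" and C: "gauss_admissible TYPE(real) p C" and s: "0 < s" "s < 1 / p"
  shows "ennreal (gauss_power_const s) \<le> C"
proof -
  define f where "f x = \<bar>x\<bar> powr (- s) * indicator {-1..1} x" for x :: real
  define I where "I = (\<integral>\<^sup>+ x. ennreal (f x powr p) \<partial>lborel)"
  have [measurable]: "f \<in> borel_measurable borel"
    unfolding f_def by measurable
  have "s * p < 1" using s p by (simp add: field_simps)
  have "1 / p < 1" using p by simp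
  with s have "s < 1" by linarith
  have f_powr: "ennreal (f x powr p) = ennreal (\<bar>x\<bar> powr (- s * p)) * indicator {-1..1} x" for x
    using p by (auto simp: f_def indicator_def powr_powr)
  have "I = (\<integral>\<^sup>+ x. 2 * (ennreal (x powr (- s * p)) * indicator {0..1} x) \<partial>lborel)"
    unfolding I_def
    by (subst nn_integral_fold) (auto intro!: nn_integral_cong simp: f_powr indicator_def mult_2)
  also have "\<dots> = 2 * ennreal (1 / (1 - s * p))"
    using nn_integral_powr_from_0[of "- s * p"] \<open>s * p < 1\<close> by (subst nn_integral_cmult) simp_all
  finally have I: "I = 2 * ennreal (1 / (1 - s * p))" .
  then have "0 < I" "I < \<infinity>"
    using \<open>s * p < 1\<close> by (simp_all add: ennreal_mult_less_top ennreal_zero_less_mult_iff)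
  have "ennreal_powr (ennreal (gauss_power_const s)) p * I
      = (\<integral>\<^sup>+ x. ennreal_powr (ennreal (gauss_power_const s)) p * ennreal (f x powr p) \<partial>lborel)"
    unfolding I_def by (simp add: nn_integral_cmult)
  also have "\<dots> \<le> (\<integral>\<^sup>+ x. ennreal_powr (gauss_sup (\<lambda>y. ennreal (f y)) x) p \<partial>lborel)"
  proof (intro nn_integral_mono)
    fix x
    have "ennreal (gauss_power_const s) * ennreal (f x) \<le> gauss_sup (\<lambda>y. ennreal (f y)) x"
      using gauss_sup_power_ge[of s x] s \<open>s < 1\<close>
      \<comment> \<open>In the remaining cases \<open>f x\<close> is 0: outside [-1, 1] by
        truncation, and at the origin because \<open>0 powr (- s) = 0\<close>.\<close>
      by (cases "x \<noteq> 0 \<and> \<bar>x\<bar> \<le> 1") (auto simp: f_def[abs_def] indicator_def abs_le_iff)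
    then show "ennreal_powr (ennreal (gauss_power_const s)) p * ennreal (f x powr p)
        \<le> ennreal_powr (gauss_sup (\<lambda>y. ennreal (f y)) x) p"
      using p ennreal_powr_mono[of p "ennreal (gauss_power_const s) * ennreal (f x)"]
      by (simp add: ennreal_powr_mult ennreal_powr_ennreal f_def)
  qed
  also have "\<dots> \<le> ennreal_powr C p * I"
    unfolding I_def using \<open>I < \<infinity>\<close> by (intro gauss_admissibleD[OF C]) (auto simp: I_def f_def)
  finally have "I * ennreal_powr (ennreal (gauss_power_const s)) p \<le> I * ennreal_powr C p"
    by (simp add: mult.commute)
  then have "ennreal_powr (ennreal (gauss_power_const s)) p \<le> ennreal_powr C p"
    using \<open>0 < I\<close> \<open>I < \<infinity>\<close> by (subst (asm) ennreal_mult_le_mult_iff) auto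
  then show ?thesis
    using p by (simp add: ennreal_powr_le_iff)
qed

text \<open>The term \<open>1 / (1 - s)\<close> dominates the bracket, and numerical estimates of
  the prefactor and of the correction leave a coefficient above 0.4.\<close>

lemma gauss_power_const_ge:
  assumes "0 < s" "s < 1"
  shows "(405 / 1000) / (1 - s) \<le> gauss_power_const s"
proof -
  have e: "exp 1 \<le> (2.7183::real)"
  proof -
    have "exp 1 - 5837465777 / 2147483648 \<le> (inverse(2 ^ 32)::real)"
      using e_approx_32 unfolding abs_le_iff by blast
    moreover have "5837465777 / 2147483648 + inverse(2 ^ 32) \<le> (2.7183::real)" by simp
    ultimately show ?thesis by linarith
  qed
  have "(exp (1 / 2) * sqrt (2 * pi))\<^sup>2 = exp 1 * (2 * pi)"
    using exp_double[of "1 / 2 :: real"] by (simp add: power_mult_distrib)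
  \<comment> \<open>The crude bound \<open>pi < 4\<close> is good enough: the product is 21.7464,
    just below the square of 4.664.\<close>
  also have "\<dots> \<le> 2.7183 * (2 * 4)"
    using e pi_less_4 by (intro mult_mono) auto
  also have "\<dots> \<le> 4.664\<^sup>2"
    by (simp add: power2_eq_square)
  finally have "exp (1 / 2) * sqrt (2 * pi) \<le> 4.664"
    by (rule power2_le_imp_le) simp
  then have "2 / 4.664 \<le> 2 / (exp (1 / 2) * sqrt (2 * pi))"
    by (intro divide_left_mono) auto
  also have "\<dots> = 2 * exp (- 1 / 2) / sqrt (2 * pi)"
    by (simp add: exp_minus field_simps)
  finally have k: "2 / 4.664 \<le> 2 * exp (- 1 / 2) / sqrt (2 * pi)" .
  \<comment> \<open>Clearing denominators gives \<open>20 * (1 - s) <= 4 * (5 - s)\<close>, with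
    equality at \<open>s = 0\<close>. The correction thus costs at most 5 percent of the main term,
    and \<open>0.95 * 2 / 4.664\<close> exceeds 0.407.\<close>
  have "1 / (4 * (5 - s)) \<le> (1 / 20) / (1 - s)"
    using assms by (simp add: field_simps)
  moreover have "(95 / 100) / (1 - s) = 1 / (1 - s) - (1 / 20) / (1 - s)"
    by (subst diff_divide_distrib[symmetric]) simp
  ultimately have "(95 / 100) / (1 - s) \<le> 1 / (1 - s) - 1 / (4 * (5 - s))"
    by linarith
  then have "2 / 4.664 * ((95 / 100) / (1 - s)) \<le> gauss_power_const s"
    unfolding gauss_power_const_def using assms k by (intro mult_mono) auto
  moreover have "(405 / 1000) / (1 - s) \<le> 2 / 4.664 * ((95 / 100) / (1 - s))"
    using assms by (simp add: field_simps)
  ultimately show ?thesis by linarith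
qed

text \<open>At every point of the open interval the averages of its indicator tend to 1 as the time
  shrinks, so the maximal function is at least the indicator.\<close>

lemma gauss_admissible_ge_1:
  assumes p: "1 < p" and C: "gauss_admissible TYPE(real) p C"
  shows "1 \<le> C"
proof -
  let ?i = "indicator {-1<..<1} :: real \<Rightarrow> real"
  have powr: "ennreal (?i x powr p) = indicator {-1<..<1} x" for x
    using p by (auto simp: indicator_def)
  have sup: "1 \<le> gauss_sup (\<lambda>y. ennreal (?i y)) u" if u: "\<bar>u\<bar> < 1" for u
  proof (rule LIMSEQ_le_const2)
    have lim: "(\<lambda>n. 1 / real (Suc n)) \<longlonglongrightarrow> 0"
      by real_asymp
    show "(\<lambda>n. gauss_conv (1 / real (Suc n)) (\<lambda>y. ennreal (?i y)) u) \<longlonglongrightarrow> 1"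
      using gauss_conv_indicator_tendsto[OF lim u]
      by (subst gauss_conv_real_rescale) (simp_all add: ennreal_indicator)
    show "\<exists>N. \<forall>n\<ge>N. gauss_conv (1 / real (Suc n)) (\<lambda>y. ennreal (?i y)) u \<le> gauss_sup (\<lambda>y. ennreal (?i y)) u"
      unfolding gauss_sup_def by (intro exI allI impI SUP_upper) auto
  qed
  have "2 = (\<integral>\<^sup>+ x. indicator {-1<..<1::real} x \<partial>lborel)"
    by simp
  also have "\<dots> \<le> (\<integral>\<^sup>+ x. ennreal_powr (gauss_sup (\<lambda>y. ennreal (?i y)) x) p \<partial>lborel)"
  proof (intro nn_integral_mono)
    fix x :: real
    show "indicator {-1<..<1} x \<le> ennreal_powr (gauss_sup (\<lambda>y. ennreal (?i y)) x) p"
      using p ennreal_powr_mono[OF _ sup, of p x] ennreal_powr_ennreal[of 1 p]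
      by (auto simp: indicator_def abs_less_iff)
  qed
  also have "\<dots> \<le> ennreal_powr C p * (\<integral>\<^sup>+ x. ennreal (?i x powr p) \<partial>lborel)"
    by (intro gauss_admissibleD[OF C]) (auto simp: powr)
  also have "\<dots> = ennreal_powr C p * 2"
    by (simp add: powr)
  finally have "2 * 1 \<le> 2 * ennreal_powr C p"
    by (simp add: mult.commute)
  then have "ennreal_powr 1 p \<le> ennreal_powr C p"
    using ennreal_powr_ennreal[of 1 p] by (subst (asm) ennreal_mult_le_mult_iff) auto
  then show ?thesis
    using p by (simp add: ennreal_powr_le_iff)
qed

lemma gauss_admissible_ge:
  assumes p: "1 < p" and C: "gauss_admissible TYPE(real) p C"
  shows "ennreal (max (405 / 1000 * (p / (p - 1))) 1) \<le> C"
proof (cases C)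
  case (real c)
  have c1: "1 \<le> c"
    using gauss_admissible_ge_1[OF p C] real by (simp flip: ennreal_1)
  have "405 / 1000 \<le> c * (1 - s)" if s: "0 < s" "s < 1 / p" for s
  proof -
    have "1 / p < 1" using p by simp
    with s have "s < 1" by linarith
    with gauss_power_const_ge[of s] gauss_admissible_ge_power_const[OF p C s] real s
    have "(405 / 1000) / (1 - s) \<le> c" by auto
    with \<open>s < 1\<close> show ?thesis by (simp add: field_simps)
  qed
  \<comment> \<open>With the denominator cleared, both sides are continuous in \<open>s\<close> and
    the inequality survives the limit from the left. At \<open>s = 1 / p\<close> the factor is
    \<open>1 - 1 / p = (p - 1) / p\<close>.\<close>
  then have "\<forall>\<^sub>F s in at_left (1 / p). 405 / 1000 \<le> c * (1 - s)"
    using p by (intro eventually_at_leftI[of 0]) auto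
  moreover have "((\<lambda>s. c * (1 - s)) \<longlongrightarrow> c * (1 - 1 / p)) (at_left (1 / p))"
    by (intro tendsto_intros)
  ultimately have "405 / 1000 \<le> c * (1 - 1 / p)"
    by (intro tendsto_lowerbound) auto
  then have "405 / 1000 * (p / (p - 1)) \<le> c"
    using p by (simp add: field_simps)
  with c1 real show ?thesis by (simp add: ennreal_leI)
qed simp

lemma gauss_max_norm_real_ge:
  assumes p: "1 < p"
  shows "ennreal (max (405 / 1000 * (p / (p - 1))) 1) \<le> gauss_max_norm TYPE(real) p"
  using gauss_admissible_ge[OF p] by (auto simp: gauss_max_norm_eq[OF p] intro!: Inf_greatest)

theorem theorem1p6:
  shows
    "(DIM('b::euclidean_space) = DIM('a::euclidean_space) + 1 \<longrightarrow>
        (\<forall>p::real. 1 < p \<longrightarrow> gauss_max_norm TYPE('b) p \<ge> gauss_max_norm TYPE('a) p))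
     \<and> (\<exists>c::real. 4 / 10 < c \<and> c \<le> 1 \<and>
          (\<forall>p::real. 1 < p \<longrightarrow>
             gauss_max_norm TYPE(real) p \<ge> ennreal (max (c * (p / (p - 1))) 1)))
     \<and> (\<forall>p::real. 1 < p \<and> p < 5 / 3 \<longrightarrow>
          gauss_max_norm TYPE(real) p > ennreal (2 / 5 * (p / (p - 1)))
          \<and> 2 / 5 * (p / (p - 1)) > 1)"
proof (intro conjI allI impI)
  fix p :: real
  assume "DIM('b) = DIM('a) + 1" "1 < p"
  then show "gauss_max_norm TYPE('a) p \<le> gauss_max_norm TYPE('b) p"
    by (rule gauss_max_norm_dim_step)
next
  show "\<exists>c::real. 4 / 10 < c \<and> c \<le> 1 \<and>
      (\<forall>p::real. 1 < p \<longrightarrow> gauss_max_norm TYPE(real) p \<ge> ennreal (max (c * (p / (p - 1))) 1))"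
    by (intro exI[of _ "405 / 1000"] conjI allI impI gauss_max_norm_real_ge) auto
next
  fix p :: real
  assume p: "1 < p \<and> p < 5 / 3"
  then show "2 / 5 * (p / (p - 1)) > 1"
    by (simp add: field_simps)
  \<comment> \<open>Strictness comes from the margin between 0.405 and 2/5.\<close>
  have "2 / 5 * (p / (p - 1)) < max (405 / 1000 * (p / (p - 1))) 1"
    using p by (intro less_max_iff_disj[THEN iffD2] disjI1 mult_strict_right_mono) auto
  then have "ennreal (2 / 5 * (p / (p - 1))) < ennreal (max (405 / 1000 * (p / (p - 1))) 1)"
    using p by (intro ennreal_lessI) auto
  also have "\<dots> \<le> gauss_max_norm TYPE(real) p"
    using p by (intro gauss_max_norm_real_ge) auto
  finally show "ennreal (2 / 5 * (p / (p - 1))) < gauss_max_norm TYPE(real) p" .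
qed

end
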